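(* Let $d \ge 1$ and let $S = \{ s_1 < s_2 < \dots < s_k\} \subseteq \{0,1,\dots,d\}$ be nonempty. Let $A, B \subseteq [d]$ with $|A| = s_i \le s_j = |B|$ for some indices $i,j$. Then the segment $[\mathbf{e}_A, \mathbf{e}_B]$ is an edge of $\Delta(d,S)$ if and only if (i) $A \subset B$ and $j = i+1$, or (ii) $i = j$, $|A \triangle B| = 2$, and $\{s_i - 1, s_i + 1\} \not\subset S$.
   Context: For $d \ge 1$ and nonempty $S \subseteq \{0,1,\dots,d\}$, the $S$-hypersimplex is $\Delta(d,S) = \operatorname{conv}\{ \mathbf{v} \in \{0,1\}^d : v_1 + \cdots + v_d \in S\} \subset \mathbb{R}^d$. For $A \subseteq [d] = \{1,\dots,d\}$, $\mathbf{e}_A \in \{0,1\}^d$ denotes the indicator vector of $A$ (so $(\mathbf{e}_A)_i = 1$ iff $i \in A$); the vertices of $\Delta(d,S)$ are the $\mathbf{e}_A$ with $|A| \in S$. $A \triangle B = (A\cup B)\setminus(A \cap B)$ is the symmetric difference, and $[\mathbf{p},\mathbf{q}]$ denotes the segment joining $\mathbf{p}$ and $\mathbf{q}$. *)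

theory Defs
  imports "HOL-Analysis.Analysis"
begin

text \<open>Coordinates are indexed by a finite type \<open>'d\<close> in place of \<open>[d]\<close>, so \<open>d = CARD('d)\<close>.\<close>

definition indicator_vec :: "'d::finite set \<Rightarrow> real ^ 'd"
  where "indicator_vec A = (\<chi> i. if i \<in> A then 1 else 0)"

definition hypersimplex :: "nat set \<Rightarrow> (real ^ 'd::finite) set"
  where "hypersimplex S =
    convex hull {v. (\<forall>i. v $ i \<in> {0, 1}) \<and> (\<Sum>i\<in>UNIV. v $ i) \<in> real ` S}"

end

theory Submission
  imports Defs
begin

text \<open>
  If a linear functional on the vertices \<open>e\<^sub>X\<close> is maximised exactly at \<open>e\<^sub>A\<close> and \<open>e\<^sub>B\<close>, then the
  segment is an edge. Conversely, the complement of a face in a convex set is convex, so no point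
  of an edge \<open>[e\<^sub>A, e\<^sub>B]\<close> is a convex combination of other vertices. The obstructing combinations
  are the midpoint of the two vertices obtained by exchanging one element between \<open>A\<close> and \<open>B\<close>, the
  midpoint of the vertices of \<open>A \<inter> B\<close> and \<open>A \<union> B\<close>, and, for \<open>A \<subseteq> B\<close> on non-consecutive levels,
  the barycentre of all \<open>e\<^sub>X\<close> with \<open>A \<subseteq> X \<subseteq> B\<close> on an intermediate level.
\<close>

section \<open>Faces of convex sets and the vertices of the hypersimplex\<close>

text \<open>A point of \<open>T\<close> in an open segment with both ends in \<open>S\<close> would
  force the ends into \<open>T\<close>, by the defining property of a face.\<close>

lemma face_of_imp_convex_Diff:
  assumes "T face_of S" "convex S"
  shows "convex (S - T)"
  unfolding convex_contains_open_segment
proof (intro ballI subsetI)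
  fix x y z assume xy: "x \<in> S - T" "y \<in> S - T" and z: "z \<in> open_segment x y"
  then have "z \<in> S"
    using assms(2) by (meson DiffD1 convex_contains_open_segment subsetD)
  then show "z \<in> S - T"
    using face_ofD[OF assms(1) z] xy by blast
qed

lemma indicator_vec_nth [simp]: "indicator_vec A $ i = (if i \<in> A then 1 else 0)"
  by (simp add: indicator_vec_def)

lemma indicator_vec_eq_iff [simp]: "indicator_vec A = indicator_vec B \<longleftrightarrow> A = B"
  by (auto simp: vec_eq_iff split: if_splits)

text \<open>A 0/1 vector is determined by the set \<open>X\<close> of its ones, and its coordinate
  sum is \<open>card X\<close>. From here on vertices are handled as sets.\<close>

lemma hypersimplex_eq:
  "(hypersimplex S :: (real ^ 'd::finite) set) = convex hull (indicator_vec ` {X. card X \<in> S})"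
proof -
  have "{v :: real ^ 'd. (\<forall>i. v $ i \<in> {0, 1}) \<and> (\<Sum>i\<in>UNIV. v $ i) \<in> real ` S}
      = indicator_vec ` {X. card X \<in> S}" (is "?V = ?W")
  proof (intro equalityI subsetI)
    fix v assume v: "v \<in> ?V"
    define X where "X = {i. v $ i = 1}"
    have v_eq: "v = indicator_vec X"
      using v by (auto simp: vec_eq_iff X_def)
    have "(\<Sum>i\<in>UNIV. v $ i) = real (card X)"
      by (simp add: v_eq sum.If_cases)
    then have "card X \<in> S" using v by auto
    then show "v \<in> ?W" using v_eq by blast
  qed (auto simp: sum.If_cases)
  then show ?thesis by (simp add: hypersimplex_def)
qed

text \<open>For \<open>u\<close> strictly between 0 and 1, a coordinate in which \<open>A\<close>
  and \<open>B\<close> differ takes a value strictly between 0 and 1, which no indicator vector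
  has.\<close>

lemma indicator_vec_in_closed_segment:
  assumes "indicator_vec X \<in> closed_segment (indicator_vec A) (indicator_vec B)"
  shows "X = A \<or> X = B"
proof -
  obtain u where u: "0 \<le> u" "u \<le> 1"
    and eq: "indicator_vec X = (1 - u) *\<^sub>R indicator_vec A + u *\<^sub>R indicator_vec B"
    using assms by (auto simp: closed_segment_def)
  have pt: "(if i \<in> X then 1 else 0) = (1 - u) * (if i \<in> A then 1 else 0) + u * (if i \<in> B then 1 else 0)" for i
    using arg_cong[OF eq, of "\<lambda>v. v $ i"] by simp
  consider "u = 0" | "u = 1" | "u \<noteq> 0" "u \<noteq> 1" by blast
  then show ?thesis
  proof cases
    case 1
    with eq show ?thesis by simp
  next
    case 2
    with eq show ?thesis by simp
  next
    case 3
    then have "i \<in> X \<longleftrightarrow> i \<in> A" for i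
      using pt[of i] by (auto split: if_splits)
    then show ?thesis by blast
  qed
qed

section \<open>Criteria for being an edge and for not being one\<close>

text \<open>The hyperplane of value \<open>c\<close> supports the polytope and cuts out a face. The
  only vertices on it are those of \<open>A\<close> and \<open>B\<close>, and
  \<open>A \<noteq> B\<close> makes the face one-dimensional.\<close>

lemma edge_of_hypersimplexI:
  fixes w :: "real ^ 'd::finite"
  assumes "A \<noteq> B" "card A \<in> S" "card B \<in> S"
    and A: "w \<bullet> indicator_vec A = c" and B: "w \<bullet> indicator_vec B = c"
    and le: "\<And>X. card X \<in> S \<Longrightarrow> w \<bullet> indicator_vec X \<le> c"
    and eq: "\<And>X. card X \<in> S \<Longrightarrow> w \<bullet> indicator_vec X = c \<Longrightarrow> X = A \<or> X = B"
  shows "closed_segment (indicator_vec A) (indicator_vec B) edge_of hypersimplex S"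
proof -
  define V :: "(real ^ 'd) set" where "V = indicator_vec ` {X. card X \<in> S}"
  define F where "F = convex hull V \<inter> {x. w \<bullet> x = c}"
  have "convex hull V \<subseteq> {x. w \<bullet> x \<le> c}"
    using le by (intro hull_minimal convex_halfspace_le) (auto simp: V_def)
  then have face: "F face_of convex hull V"
    unfolding F_def by (intro face_of_Int_supporting_hyperplane_le) auto
  have "compact V"
    unfolding V_def by (intro finite_imp_compact finite_imageI) simp
  \<comment> \<open>A face of the hull of a compact set is the hull of some of its points, so only
    the vertices on the hyperplane have to be identified.\<close>
  then obtain V' where V': "V' \<subseteq> V" "F = convex hull V'"
    using face face_of_convex_hull_subset by blast
  have "V' \<subseteq> {indicator_vec A, indicator_vec B}"
  proof
    fix v assume v: "v \<in> V'"
    then have "v \<in> F" unfolding V'(2) by (rule hull_inc)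
    then have "w \<bullet> v = c" by (simp add: F_def)
    moreover obtain X where "card X \<in> S" "v = indicator_vec X" using v V'(1) by (auto simp: V_def)
    ultimately show "v \<in> {indicator_vec A, indicator_vec B}"
      using eq by blast
  qed
  then have "F \<subseteq> closed_segment (indicator_vec A) (indicator_vec B)"
    unfolding V'(2) segment_convex_hull by (rule hull_mono)
  moreover have "indicator_vec A \<in> V" "indicator_vec B \<in> V"
    using assms(2,3) by (auto simp: V_def)
  then have "indicator_vec A \<in> F" "indicator_vec B \<in> F"
    using A B by (simp_all add: F_def hull_inc)
  then have "closed_segment (indicator_vec A) (indicator_vec B) \<subseteq> F"
    using face by (simp add: closed_segment_subset face_of_imp_convex)
  ultimately have "closed_segment (indicator_vec A) (indicator_vec B) = F" by blast
  moreover have "aff_dim (closed_segment (indicator_vec A) (indicator_vec B)) = 1"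
    using \<open>A \<noteq> B\<close> by (simp add: segment_convex_hull aff_dim_convex_hull)
  ultimately show ?thesis
    using face by (simp add: edge_of_def hypersimplex_eq V_def)
qed

text \<open>The complement of the edge is convex and contains every vertex coming from
  \<open>\<X>\<close>, hence also their hull. A common point of the segment and such a hull
  therefore shows that the segment is not an edge.\<close>

lemma edge_of_hypersimplex_disjoint:
  assumes "closed_segment (indicator_vec A) (indicator_vec B) edge_of hypersimplex S"
    and "\<And>X. X \<in> \<X> \<Longrightarrow> card X \<in> S \<and> X \<noteq> A \<and> X \<noteq> B"
  shows "closed_segment (indicator_vec A) (indicator_vec B) \<inter> convex hull (indicator_vec ` \<X>) = {}"
proof -
  let ?seg = "closed_segment (indicator_vec A) (indicator_vec B)"
  have "?seg face_of hypersimplex S"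
    using assms(1) by (simp add: edge_of_def)
  then have "convex (hypersimplex S - ?seg)"
    by (simp add: face_of_imp_convex_Diff hypersimplex_eq)
  moreover have "indicator_vec X \<in> hypersimplex S - ?seg" if "X \<in> \<X>" for X
  proof
    show "indicator_vec X \<in> hypersimplex S"
      unfolding hypersimplex_eq using assms(2)[OF that] by (intro hull_inc) blast
    show "indicator_vec X \<notin> ?seg"
      using assms(2)[OF that] indicator_vec_in_closed_segment by blast
  qed
  then have "indicator_vec ` \<X> \<subseteq> hypersimplex S - ?seg" by blast
  ultimately have "convex hull (indicator_vec ` \<X>) \<subseteq> hypersimplex S - ?seg"
    by (simp add: hull_minimal)
  then show ?thesis by blast
qed

text \<open>Equal sums mean equal midpoints, so one point would lie both on the edge and in the hull
  of vertices off the edge.\<close>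

lemma edge_of_hypersimplex_sum_neq:
  assumes "closed_segment (indicator_vec A) (indicator_vec B) edge_of hypersimplex S"
    and "card X \<in> S" "card Y \<in> S" "X \<noteq> A" "X \<noteq> B" "Y \<noteq> A" "Y \<noteq> B"
  shows "indicator_vec X + indicator_vec Y \<noteq> indicator_vec A + indicator_vec B"
proof
  assume "indicator_vec X + indicator_vec Y = indicator_vec A + indicator_vec B"
  then have "midpoint (indicator_vec X) (indicator_vec Y) = midpoint (indicator_vec A) (indicator_vec B)"
    by (simp add: midpoint_def)
  then have "midpoint (indicator_vec A) (indicator_vec B) \<in> convex hull (indicator_vec ` {X, Y})"
    by (metis image_insert image_empty midpoint_in_closed_segment segment_convex_hull)
  moreover have "closed_segment (indicator_vec A) (indicator_vec B)
      \<inter> convex hull (indicator_vec ` {X, Y}) = {}"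
    by (rule edge_of_hypersimplex_disjoint[OF assms(1)]) (use assms(2-) in blast)
  ultimately show False
    using midpoint_in_closed_segment by blast
qed

section \<open>The barycentre of an intermediate level\<close>

text \<open>Deleting \<open>x\<close> is a bijection onto the subsets of \<open>D - {x}\<close> of
  size \<open>m - 1\<close>. For \<open>m = 0\<close> the truncated \<open>m - 1\<close> would give
  one set instead of none.\<close>

lemma card_subsets_containing:
  assumes "finite D" "x \<in> D" "0 < m"
  shows "card {Y. Y \<subseteq> D \<and> card Y = m \<and> x \<in> Y} = (card D - 1) choose (m - 1)"
proof -
  have "bij_betw (insert x) {Z. Z \<subseteq> D - {x} \<and> card Z = m - 1} {Y. Y \<subseteq> D \<and> card Y = m \<and> x \<in> Y}"
  proof (rule bij_betw_byWitness[where f' = "\<lambda>Y. Y - {x}"])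
    show "insert x ` {Z. Z \<subseteq> D - {x} \<and> card Z = m - 1} \<subseteq> {Y. Y \<subseteq> D \<and> card Y = m \<and> x \<in> Y}"
    proof safe
      fix Z assume Z: "Z \<subseteq> D - {x}" "card Z = m - 1"
      then have "finite Z" "x \<notin> Z" using assms(1) finite_subset by blast+
      then show "card (insert x Z) = m" using Z assms(3) by simp
    qed (use assms in auto)
  qed auto
  then have "card {Y. Y \<subseteq> D \<and> card Y = m \<and> x \<in> Y} = card {Z. Z \<subseteq> D - {x} \<and> card Z = m - 1}"
    by (simp add: bij_betw_same_card)
  also have "\<dots> = card (D - {x}) choose (m - 1)"
    using assms(1) by (simp add: n_subsets)
  finally show ?thesis using assms by simp
qed

text \<open>Averaging over all sets of size \<open>l\<close> between \<open>A\<close> and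
  \<open>B\<close> gives 1 on \<open>A\<close>, 0 outside \<open>B\<close> and, by symmetry, one
  common value on \<open>B - A\<close>. Such a vector lies on the segment.\<close>

lemma barycentre_of_level:
  fixes A B :: "'d::finite set"
  assumes "A \<subseteq> B" "card A < l" "l < card B"
  shows "closed_segment (indicator_vec A) (indicator_vec B)
    \<inter> convex hull (indicator_vec ` {X. card X = l}) \<noteq> {}"
proof -
  define D where "D = B - A"
  define n where "n = card D"
  define m where "m = l - card A"
  define \<Y> where "\<Y> = {Y. Y \<subseteq> D \<and> card Y = m}"
  define N where "N = real (card \<Y>)"
  have n: "n = card B - card A"
    unfolding n_def D_def using assms(1) by (simp add: card_Diff_subset)
  have m: "0 < m" "m < n" using assms by (auto simp: n m_def)
  have N: "N = real (n choose m)"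
    by (simp add: N_def \<Y>_def n_def n_subsets)
  then have Npos: "N > 0" using m by simp
  \<comment> \<open>This is the fraction of the sets in \<open>\<Y>\<close> that contain a given
    element of \<open>D\<close>, and also the parameter of the barycentre on the segment.\<close>
  define t where "t = real m / real n"
  have count: "real (card {Y \<in> \<Y>. i \<in> Y}) / N = t" if "i \<in> D" for i
  proof -
    have "{Y \<in> \<Y>. i \<in> Y} = {Y. Y \<subseteq> D \<and> card Y = m \<and> i \<in> Y}"
      by (auto simp: \<Y>_def)
    then have "card {Y \<in> \<Y>. i \<in> Y} = (n - 1) choose (m - 1)"
      using card_subsets_containing[of D i m] that m by (simp add: n_def)
    \<comment> \<open>Double counting of pairs of an element and a set of size \<open>m\<close>
      containing it, in the form of the absorption identity for binomials.\<close>
    moreover have "real m * N = real n * real ((n - 1) choose (m - 1))"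
      unfolding N of_nat_mult[symmetric] using times_binomial_minus1_eq[OF m(1)] by simp
    ultimately show ?thesis using Npos m by (simp add: t_def field_simps)
  qed
  define p :: "real ^ 'd" where "p = (\<Sum>Y\<in>\<Y>. (1 / N) *\<^sub>R indicator_vec (A \<union> Y))"
  have "p \<in> convex hull (indicator_vec ` {X. card X = l})"
    unfolding p_def
  proof (rule convex_sum)
    show "(\<Sum>Y\<in>\<Y>. 1 / N) = 1" using Npos by (simp flip: N_def)
    fix Y assume Y: "Y \<in> \<Y>"
    have "card (A \<union> Y) = card A + card Y"
      using Y by (intro card_Un_disjoint) (auto simp: \<Y>_def D_def)
    then have "card (A \<union> Y) = l" using Y assms by (simp add: \<Y>_def m_def)
    then show "indicator_vec (A \<union> Y) \<in> convex hull (indicator_vec ` {X. card X = l})"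
      by (intro hull_inc) auto
  qed (use Npos in auto)
  moreover have "p = (1 - t) *\<^sub>R indicator_vec A + t *\<^sub>R indicator_vec B"
  proof (subst vec_eq_iff, intro allI)
    fix i
    have "p $ i = (\<Sum>Y\<in>\<Y>. if i \<in> A \<union> Y then 1 / N else 0)"
      unfolding p_def sum_component by (intro sum.cong) auto
    also have "\<dots> = real (card {Y \<in> \<Y>. i \<in> A \<union> Y}) / N"
      by (simp add: sum.If_cases Int_def conj_commute)
    finally have pi: "p $ i = real (card {Y \<in> \<Y>. i \<in> A \<union> Y}) / N" .
    consider "i \<in> A" | "i \<in> D" "i \<notin> A" | "i \<notin> B"
      by (auto simp: D_def)
    then show "p $ i = ((1 - t) *\<^sub>R indicator_vec A + t *\<^sub>R indicator_vec B) $ i"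
    proof cases
      case 1
      then have "i \<in> B" using assms(1) by blast
      with 1 show ?thesis using Npos by (simp add: pi flip: N_def)
    next
      case 2
      then have "i \<in> B" by (simp add: D_def)
      with 2 show ?thesis using count[of i] by (simp add: pi)
    next
      case 3
      then have "i \<notin> A" using assms(1) by blast
      moreover have none: "{Y \<in> \<Y>. i \<in> Y} = {}" using 3 by (auto simp: \<Y>_def D_def)
      ultimately show ?thesis using 3 by (simp add: pi none del: Collect_empty_eq)
    qed
  qed
  then have "p \<in> closed_segment (indicator_vec A) (indicator_vec B)"
    using m by (auto simp: closed_segment_def t_def intro!: exI[of _ t])
  ultimately show ?thesis by blast
qed

section \<open>Linear functionals that exhibit the edges\<close>

lemma inner_indicator_vec: "w \<bullet> indicator_vec X = (\<Sum>i\<in>X. w $ i)"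
proof -
  have "w \<bullet> indicator_vec X = (\<Sum>i\<in>UNIV. if i \<in> X then w $ i else 0)"
    by (auto simp: inner_vec_def intro!: sum.cong)
  then show ?thesis by (simp add: sum.If_cases)
qed

text \<open>Both functionals used below are constant on three blocks of coordinates, so that their
  values at vertices reduce to three cardinalities.\<close>

lemma inner_three_valued:
  fixes P Q X :: "'d::finite set"
  assumes "P \<inter> Q = {}"
  shows "(\<chi> i. if i \<in> P then p else if i \<in> Q then q else - r) \<bullet> indicator_vec X
    = p * card (X \<inter> P) + q * card (X \<inter> Q) - r * card (X - P - Q)"
proof -
  let ?w = "\<lambda>i. if i \<in> P then p else if i \<in> Q then q else - r"
  have "sum ?w X = sum ?w (X \<inter> P) + sum ?w (X - P)"
    by (rule sum.Int_Diff) simp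
  moreover have "(X - P) \<inter> Q = X \<inter> Q" using assms by blast
  then have "sum ?w (X - P) = sum ?w (X \<inter> Q) + sum ?w (X - P - Q)"
    using sum.Int_Diff[of "X - P" ?w Q] by simp
  moreover have "sum ?w (X \<inter> P) = (\<Sum>i\<in>X \<inter> P. p)" by (intro sum.cong) auto
  moreover have "sum ?w (X \<inter> Q) = (\<Sum>i\<in>X \<inter> Q. q)" using assms by (intro sum.cong) auto
  moreover have "sum ?w (X - P - Q) = (\<Sum>i\<in>X - P - Q. - r)" by (intro sum.cong) auto
  ultimately show ?thesis by (simp add: inner_indicator_vec)
qed

text \<open>The functional rewards elements of \<open>A\<close>, ignores \<open>B - A\<close> and
  penalises everything outside \<open>B\<close>. Its maximum is attained exactly when
  \<open>A \<subseteq> X \<subseteq> B\<close>, and the gap in \<open>S\<close> leaves only the two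
  ends of this interval.\<close>

lemma edge_of_consecutive_levels:
  fixes A B :: "'d::finite set"
  assumes "A \<subset> B" "card A \<in> S" "card B \<in> S"
    and gap: "\<And>l. l \<in> S \<Longrightarrow> card A < l \<Longrightarrow> l < card B \<Longrightarrow> False"
  shows "closed_segment (indicator_vec A) (indicator_vec B) edge_of hypersimplex S"
proof (rule edge_of_hypersimplexI)
  let ?w = "(\<chi> i. if i \<in> A then 1 else if i \<in> B - A then 0 else - 1) :: real ^ 'd"
  have w: "?w \<bullet> indicator_vec X = real (card (X \<inter> A)) - card (X - A - (B - A))" for X
    using inner_three_valued[of A "B - A" 1 0 1 X] by simp
  have le: "card (X \<inter> A) \<le> card A" for X by (simp add: card_mono)
  show "A \<noteq> B" using assms(1) by blast
  show "?w \<bullet> indicator_vec A = real (card A)" unfolding w by simp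
  show "?w \<bullet> indicator_vec B = real (card A)"
    unfolding w using assms(1) by (auto simp: Int_absorb1 psubset_eq)
  fix X :: "'d set" assume X: "card X \<in> S"
  show "?w \<bullet> indicator_vec X \<le> real (card A)" unfolding w using le[of X] by linarith
  assume "?w \<bullet> indicator_vec X = real (card A)"
  then have eqs: "card (X \<inter> A) = card A" "card (X - A - (B - A)) = 0"
    unfolding w using le[of X] by linarith+
  have "X \<inter> A = A" using eqs(1) by (simp add: card_subset_eq)
  then have sub: "A \<subseteq> X" "X \<subseteq> B" using eqs(2) assms(1) by auto
  then have "card A \<le> card X" "card X \<le> card B" by (simp_all add: card_mono)
  moreover have "\<not> (card A < card X \<and> card X < card B)" using gap[OF X] by blast
  ultimately have "card A = card X \<or> card X = card B" by linarith
  then show "X = A \<or> X = B"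
    using card_subset_eq[OF _ sub(1)] card_subset_eq[OF _ sub(2)] by auto
qed (use assms in auto)

text \<open>Weights 2 on \<open>C\<close> and -2 outside \<open>C \<union> {a, b}\<close> outweigh
  the weight \<open>q\<close> on \<open>a\<close> and \<open>b\<close>, so a maximiser contains
  \<open>C\<close> and adds at most \<open>a\<close> and \<open>b\<close>. Parity then shows that it
  adds exactly one of them.\<close>

lemma edge_of_same_level:
  fixes C :: "'d::finite set"
  assumes ab: "a \<noteq> b" "a \<notin> C" "b \<notin> C" and S: "Suc (card C) \<in> S"
    and gap: "card C \<notin> S \<or> Suc (Suc (card C)) \<notin> S"
  shows "closed_segment (indicator_vec (insert a C)) (indicator_vec (insert b C)) edge_of hypersimplex S"
proof -
  \<comment> \<open>The sign \<open>q\<close> is chosen so that the only set of weight above \<open>?c\<close> is the one of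
    \<open>C\<close> and \<open>C \<union> {a, b}\<close> whose level is missing from \<open>S\<close>.\<close>
  define q :: real where "q = (if card C \<in> S then 1 else - 1)"
  let ?w = "(\<chi> i. if i \<in> C then 2 else if i \<in> {a, b} then q else - 2) :: real ^ 'd"
  let ?c = "2 * real (card C) + q"
  have w: "?w \<bullet> indicator_vec X
      = 2 * real (card (X \<inter> C)) + q * card (X \<inter> {a, b}) - 2 * card (X - C - {a, b})" for X
    using inner_three_valued[of C "{a, b}" 2 q 2 X] ab by simp
  have key: "?w \<bullet> indicator_vec X \<le> ?c \<and>
      (?w \<bullet> indicator_vec X = ?c \<longrightarrow> X = insert a C \<or> X = insert b C)" if X: "card X \<in> S" for X
  proof -
    define x y z where "x = card (X \<inter> C)" and "y = card (X \<inter> {a, b})" and "z = card (X - C - {a, b})"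
    have x: "x \<le> card C" unfolding x_def by (simp add: card_mono)
    have "card (X \<inter> {a, b}) \<le> card {a, b}" by (intro card_mono) auto
    then have y: "y \<le> 2" using ab(1) by (simp add: y_def)
    have "(X - C) \<inter> {a, b} = X \<inter> {a, b}" using ab by blast
    then have cX: "card X = x + y + z"
      using card_Int_Diff[of X C] card_Int_Diff[of "X - C" "{a, b}"]
      by (simp add: x_def y_def z_def)
    \<comment> \<open>The excluded cases are \<open>X = C \<union> {a, b}\<close> with
      \<open>q = 1\<close> and \<open>X = C\<close> with \<open>q = -1\<close>.\<close>
    have excl: "\<not> (x = card C \<and> z = 0 \<and> ((q = 1 \<and> y = 2) \<or> (q = -1 \<and> y = 0)))"
    proof
      assume *: "x = card C \<and> z = 0 \<and> ((q = 1 \<and> y = 2) \<or> (q = -1 \<and> y = 0))"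
      then have "card X = card C + y" using cX by simp
      then show False using * X gap by (auto simp: q_def split: if_splits)
    qed
    have q: "q = 1 \<or> q = -1" by (simp add: q_def)
    have yc: "y = 0 \<or> y = 1 \<or> y = 2" using y by linarith
    have le: "2 * real x + q * y - 2 * z \<le> ?c"
    proof (cases "x = card C \<and> z = 0")
      case True
      then show ?thesis using excl q yc by auto
    next
      case False
      \<comment> \<open>Deviating on \<open>C\<close> or outside \<open>C \<union> {a, b}\<close>
        costs at least 2, while \<open>q * y\<close> exceeds \<open>q\<close> by at most 1.\<close>
      then have "x + 1 \<le> card C + z" using x by linarith
      then show ?thesis using q y by auto
    qed
    moreover have "X = insert a C \<or> X = insert b C" if eq: "2 * real x + q * y - 2 * z = ?c"
    proof -
      \<comment> \<open>All terms except \<open>q * y\<close> and \<open>q\<close> are even and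
        \<open>q\<close> is odd, so equality makes \<open>y\<close> odd. In each other case the
        terms are rearranged to equate an even and an odd natural number.\<close>
      have parity: "y = 1"
      proof (rule ccontr)
        assume "y \<noteq> 1"
        then consider "y = 0" "q = 1" | "y = 0" "q = -1" | "y = 2" "q = 1" | "y = 2" "q = -1"
          using yc q by blast
        then show False
        proof cases
          case 1
          then have "real (2 * x) = real (2 * card C + 2 * z + 1)" using eq by simp
          then show False unfolding of_nat_eq_iff by presburger
        next
          case 2
          then have "real (2 * x + 1) = real (2 * card C + 2 * z)" using eq by simp
          then show False unfolding of_nat_eq_iff by presburger
        next
          case 3
          then have "real (2 * x + 1) = real (2 * card C + 2 * z)" using eq by simp
          then show False unfolding of_nat_eq_iff by presburger
        next
          case 4
          then have "real (2 * x) = real (2 * card C + 2 * z + 1)" using eq by simp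
          then show False unfolding of_nat_eq_iff by presburger
        qed
      qed
      then have "real x = real (card C + z)" using eq by simp
      then have "x = card C + z" by (simp only: of_nat_eq_iff)
      then have "x = card C" "z = 0" using x by auto
      then have "C \<subseteq> X" "X \<subseteq> C \<union> {a, b}"
        using card_subset_eq[of C "X \<inter> C"] by (auto simp: x_def z_def)
      moreover obtain e where e: "X \<inter> {a, b} = {e}"
        using parity unfolding y_def by (rule card_1_singletonE)
      have "u \<in> X \<and> u \<in> {a, b} \<longleftrightarrow> u = e" for u
        using eqset_imp_iff[OF e, of u] by simp
      from this[of a] this[of b] this[of e] have "a \<in> X \<and> b \<notin> X \<or> a \<notin> X \<and> b \<in> X"
        using ab(1) by auto
      ultimately show ?thesis by blast
    qed
    moreover have wX: "?w \<bullet> indicator_vec X = 2 * real x + q * y - 2 * z"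
      unfolding w x_def y_def z_def by (rule refl)
    ultimately show ?thesis unfolding wX by blast
  qed
  have at: "?w \<bullet> indicator_vec (insert e C) = ?c" if "e \<in> {a, b}" for e
  proof -
    have "insert e C \<inter> C = C" "insert e C \<inter> {a, b} = {e}" "insert e C - C - {a, b} = {}"
      using that ab by auto
    then show ?thesis unfolding w by simp
  qed
  show ?thesis
  proof (rule edge_of_hypersimplexI)
    show "insert a C \<noteq> insert b C" using ab by blast
    show "card (insert a C) \<in> S" "card (insert b C) \<in> S" using ab S by simp_all
    show "?w \<bullet> indicator_vec (insert a C) = ?c" "?w \<bullet> indicator_vec (insert b C) = ?c"
      by (intro at; simp)+
  qed (use key in blast)+
qed

section \<open>Necessary conditions and the criterion in terms of sets\<close>

text \<open>Swapping \<open>a\<close> and \<open>b\<close> between the two sets preserves both sizes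
  and the sum of the vertices. On an edge this cannot produce two other vertices, so the swap must
  merely interchange \<open>A\<close> and \<open>B\<close>.\<close>

lemma edge_of_hypersimplex_exchange:
  fixes A B :: "'d::finite set"
  assumes edge: "closed_segment (indicator_vec A) (indicator_vec B) edge_of hypersimplex S"
    and S: "card A \<in> S" "card B \<in> S" and ab: "a \<in> A - B" "b \<in> B - A"
  shows "insert b (A - {a}) = B"
proof (rule ccontr)
  assume neq: "insert b (A - {a}) \<noteq> B"
  let ?X = "insert b (A - {a})" and ?Y = "insert a (B - {b})"
  have "card A > 0" "card B > 0" using ab by (auto simp: card_gt_0_iff)
  then have "card ?X = card A" "card ?Y = card B" using ab by auto
  moreover have "b \<in> ?X" "b \<notin> A" "a \<in> ?Y" "a \<notin> B" using ab by auto
  then have "?X \<noteq> A" "?Y \<noteq> B" by metis+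
  \<comment> \<open>Undoing the exchange in \<open>?Y = A\<close> would turn \<open>?X\<close> into
    \<open>B\<close>.\<close>
  moreover have "?Y \<noteq> A"
  proof
    assume "?Y = A"
    then have "?X = insert b (?Y - {a})" by simp
    also have "\<dots> = B" using ab by auto
    finally show False using neq by simp
  qed
  moreover have "indicator_vec ?X + indicator_vec ?Y = indicator_vec A + indicator_vec B"
    using ab by (auto simp: vec_eq_iff)
  ultimately show False
    using edge_of_hypersimplex_sum_neq[OF edge, of ?X ?Y] S neq by metis
qed

text \<open>This form avoids indices, and naming the common part \<open>C\<close> lets the levels
  below and above that of \<open>A\<close> be written without subtraction. If \<open>A\<close> is
  not contained in \<open>B\<close>, the exchange argument yields \<open>C\<close>, \<open>a\<close>
  and \<open>b\<close>.\<close>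

lemma edge_of_hypersimplex_iff:
  fixes A B :: "'d::finite set"
  assumes S: "card A \<in> S" "card B \<in> S" and le: "card A \<le> card B"
  shows "closed_segment (indicator_vec A) (indicator_vec B) edge_of hypersimplex S \<longleftrightarrow>
      A \<subset> B \<and> (\<forall>l\<in>S. \<not> (card A < l \<and> l < card B))
    \<or> (\<exists>C a b. a \<noteq> b \<and> a \<notin> C \<and> b \<notin> C \<and> A = insert a C \<and> B = insert b C
         \<and> (card C \<notin> S \<or> Suc (Suc (card C)) \<notin> S))"
    (is "?edge \<longleftrightarrow> ?up \<or> ?level")
proof
  assume edge: ?edge
  have "aff_dim (closed_segment (indicator_vec A) (indicator_vec B)) = 1"
    using edge by (simp add: edge_of_def)
  then have "A \<noteq> B" by (auto simp: aff_dim_sing)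
  show "?up \<or> ?level"
  proof (cases "A \<subseteq> B")
    case True
    have False if l: "l \<in> S" "card A < l" "l < card B" for l
    proof -
      have "closed_segment (indicator_vec A) (indicator_vec B)
          \<inter> convex hull (indicator_vec ` {X. card X = l}) = {}"
        by (rule edge_of_hypersimplex_disjoint[OF edge]) (use l in auto)
      then show False using barycentre_of_level[OF True l(2,3)] by blast
    qed
    then show ?thesis using True \<open>A \<noteq> B\<close> by blast
  next
    case False
    then obtain a where a: "a \<in> A - B" by blast
    \<comment> \<open>Since \<open>B\<close> is at least as large as \<open>A\<close>, inclusion in
      \<open>A\<close> would mean equality.\<close>
    have "\<not> B \<subseteq> A" using le \<open>A \<noteq> B\<close> by (metis card_seteq finite)
    then obtain b where b: "b \<in> B - A" by blast
    define C where "C = A - {a}"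
    have A: "A = insert a C" using a by (auto simp: C_def)
    have B: "B = insert b C" using edge_of_hypersimplex_exchange[OF edge S a b] by (simp add: C_def)
    have ab: "a \<noteq> b" "a \<notin> C" "b \<notin> C" using a b by (auto simp: C_def)
    have "card C \<notin> S \<or> Suc (Suc (card C)) \<notin> S"
    proof (rule ccontr)
      assume "\<not> ?thesis"
      \<comment> \<open>Here \<open>C\<close> is \<open>A \<inter> B\<close> and
        \<open>insert a (insert b C)\<close> is \<open>A \<union> B\<close>; with both levels in
        \<open>S\<close> they would be two further vertices with the same sum.\<close>
      have sum_eq: "indicator_vec C + indicator_vec (insert a (insert b C))
          = indicator_vec A + indicator_vec B"
        using ab by (auto simp: vec_eq_iff A B)
      from \<open>\<not> ?thesis\<close> have "card C \<in> S" "card (insert a (insert b C)) \<in> S" using ab by auto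
      moreover have "a \<in> A" "b \<in> B" "b \<notin> A" "a \<notin> B" using a b by auto
      then have "C \<noteq> A" "C \<noteq> B" "insert a (insert b C) \<noteq> A" "insert a (insert b C) \<noteq> B"
        using ab(2,3) by (metis insertCI)+
      ultimately show False
        using edge_of_hypersimplex_sum_neq[OF edge] sum_eq by blast
    qed
    then show ?thesis using A B ab by blast
  qed
next
  assume "?up \<or> ?level"
  then show ?edge
  proof
    assume ?up
    then show ?edge by (intro edge_of_consecutive_levels S) blast+
  next
    assume ?level
    then obtain C a b where C: "a \<noteq> b" "a \<notin> C" "b \<notin> C" and AB: "A = insert a C" "B = insert b C"
      and gap: "card C \<notin> S \<or> Suc (Suc (card C)) \<notin> S" by blast
    have "Suc (card C) \<in> S" using S(1) C(2) by (simp add: AB)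
    then show ?edge unfolding AB by (rule edge_of_same_level[OF C _ gap])
  qed
qed

section \<open>Translation into indices and symmetric differences\<close>

text \<open>Equal cardinality makes \<open>A - B\<close> and \<open>B - A\<close> equally large, so
  both are singletons; \<open>C\<close> is the intersection.\<close>

lemma card_sym_diff_eq_2_iff:
  assumes "finite A" "finite B" "card A = card B"
  shows "card (sym_diff A B) = 2 \<longleftrightarrow>
    (\<exists>C a b. a \<noteq> b \<and> a \<notin> C \<and> b \<notin> C \<and> A = insert a C \<and> B = insert b C)"
proof
  assume card2: "card (sym_diff A B) = 2"
  have "card (sym_diff A B) = card (A - B) + card (B - A)"
    using assms by (intro card_Un_disjoint) auto
  moreover have "card (A - B) = card (B - A)"
    using assms card_Diff_subset_Int[of A B] card_Diff_subset_Int[of B A] by (simp add: Int_commute)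
  ultimately have "card (A - B) = 1" "card (B - A) = 1" using card2 by auto
  then obtain a b where "A - B = {a}" "B - A = {b}"
    by (metis card_1_singletonE)
  then have "a \<noteq> b" "a \<notin> A \<inter> B" "b \<notin> A \<inter> B" "A = insert a (A \<inter> B)" "B = insert b (A \<inter> B)"
    by blast+
  then show "\<exists>C a b. a \<noteq> b \<and> a \<notin> C \<and> b \<notin> C \<and> A = insert a C \<and> B = insert b C" by blast
next
  assume "\<exists>C a b. a \<noteq> b \<and> a \<notin> C \<and> b \<notin> C \<and> A = insert a C \<and> B = insert b C"
  then obtain C a b where C: "a \<noteq> b" "a \<notin> C" "b \<notin> C" "A = insert a C" "B = insert b C" by blast
  then have "sym_diff A B = {a, b}" by auto
  then show "card (sym_diff A B) = 2" using C(1) by simp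
qed

text \<open>If \<open>j\<close> exceeded \<open>i + 1\<close>, the value \<open>s (i + 1)\<close>
  would lie strictly between \<open>s i\<close> and \<open>s j\<close>.\<close>

lemma strict_mono_on_consecutive_iff:
  fixes s :: "nat \<Rightarrow> nat"
  assumes s: "strict_mono_on {1..k} s" and i: "i \<in> {1..k}" and j: "j \<in> {1..k}"
  shows "j = i + 1 \<longleftrightarrow> s i < s j \<and> (\<forall>l\<in>s ` {1..k}. \<not> (s i < l \<and> l < s j))"
proof -
  have less: "s x < s y \<longleftrightarrow> x < y" if "x \<in> {1..k}" "y \<in> {1..k}" for x y
    using strict_mono_on_less[OF s that] .
  show ?thesis
  proof
    assume "j = i + 1"
    then show "s i < s j \<and> (\<forall>l\<in>s ` {1..k}. \<not> (s i < l \<and> l < s j))"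
      using i j by (auto simp: less)
  next
    assume r: "s i < s j \<and> (\<forall>l\<in>s ` {1..k}. \<not> (s i < l \<and> l < s j))"
    then have "i < j" using less i j by blast
    show "j = i + 1"
    proof (rule ccontr)
      assume "j \<noteq> i + 1"
      then have mid: "i + 1 \<in> {1..k}" "i < i + 1" "i + 1 < j" using \<open>i < j\<close> j by auto
      then show False using r less i j by blast
    qed
  qed
qed

theorem theorem2p1:
  fixes S :: "nat set" and s :: "nat \<Rightarrow> nat" and k i j :: nat
    and A B :: "'d::finite set"
  assumes "S \<noteq> {}" and "S \<subseteq> {0..CARD('d)}"
    and "S = s ` {1..k}" and "strict_mono_on {1..k} s"
    and "i \<in> {1..k}" and "j \<in> {1..k}"
    and "card A = s i" and "s i \<le> s j" and "card B = s j"
  shows "closed_segment (indicator_vec A) (indicator_vec B) edge_of (hypersimplex S :: (real ^ 'd) set)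
    \<longleftrightarrow> (A \<subseteq> B \<and> j = i + 1)
      \<or> (i = j \<and> card (sym_diff A B) = 2
          \<and> \<not> {int (s i) - 1, int (s i) + 1} \<subseteq> int ` S)"
proof -
  have S: "card A \<in> S" "card B \<in> S"
    unfolding assms(3,7,9) using assms(5,6) by (auto intro: imageI)
  \<comment> \<open>Consecutive indices give \<open>card A < card B\<close>, which turns the
    inclusion into a proper one.\<close>
  have "A \<subseteq> B \<and> card A < card B \<longleftrightarrow> A \<subset> B"
    using psubset_card_mono[of B A] by (auto simp: psubset_eq)
  then have up: "A \<subseteq> B \<and> j = i + 1 \<longleftrightarrow> A \<subset> B \<and> (\<forall>l\<in>S. \<not> (card A < l \<and> l < card B))"
    unfolding strict_mono_on_consecutive_iff[OF assms(4-6), folded assms(3,7,9)] by blast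
  have level: "i = j \<longleftrightarrow> card A = card B"
    unfolding assms(7,9) using strict_mono_on_eqD[OF assms(4) _ assms(5,6)] by blast
  \<comment> \<open>The level \<open>s i\<close> is \<open>card C + 1\<close>, so its integer
    neighbours are the images of \<open>card C\<close> and \<open>card C + 2\<close>, and
    \<open>int\<close> is injective.\<close>
  have gap: "{int (s i) - 1, int (s i) + 1} \<subseteq> int ` S \<longleftrightarrow> card C \<in> S \<and> Suc (Suc (card C)) \<in> S"
    if "a \<notin> C" "A = insert a C" for a and C :: "'d set"
  proof -
    have "int (s i) - 1 = int (card C)" "int (s i) + 1 = int (Suc (Suc (card C)))"
      unfolding assms(7)[symmetric] using that by simp_all
    then show ?thesis
      by (simp only: insert_subset empty_subsetI inj_image_mem_iff[OF inj_of_nat] simp_thms)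
  qed
  have "(\<exists>C a b. a \<noteq> b \<and> a \<notin> C \<and> b \<notin> C \<and> A = insert a C \<and> B = insert b C
         \<and> (card C \<notin> S \<or> Suc (Suc (card C)) \<notin> S))
    \<longleftrightarrow> i = j \<and> card (sym_diff A B) = 2 \<and> \<not> {int (s i) - 1, int (s i) + 1} \<subseteq> int ` S"
    (is "?L \<longleftrightarrow> ?R")
  proof
    assume ?L
    then obtain C a b where C: "a \<noteq> b" "a \<notin> C" "b \<notin> C" "A = insert a C" "B = insert b C"
      and nS: "\<not> (card C \<in> S \<and> Suc (Suc (card C)) \<in> S)" by blast
    then have eq: "card A = card B" by simp
    moreover have "card (sym_diff A B) = 2"
      unfolding card_sym_diff_eq_2_iff[OF finite finite eq] using C by blast
    ultimately show ?R unfolding gap[OF C(2,4)] level using nS by (intro conjI)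
  next
    assume R: ?R
    then have eq: "card A = card B" using level by blast
    have "card (sym_diff A B) = 2" using R by blast
    then obtain C a b where C: "a \<noteq> b" "a \<notin> C" "b \<notin> C" "A = insert a C" "B = insert b C"
      unfolding card_sym_diff_eq_2_iff[OF finite finite eq] by blast
    have "card C \<notin> S \<or> Suc (Suc (card C)) \<notin> S"
      using R unfolding gap[OF C(2,4)] by blast
    with C show ?L by (intro exI conjI)
  qed
  then show ?thesis
    unfolding edge_of_hypersimplex_iff[OF S assms(8)[folded assms(7,9)]] up by (simp only:)
qed

end
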